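(* Let $\alpha>0$. (1) Let $\boldsymbol\Phi=(\boldsymbol\varphi_S)_{S\in 2^{[m]}}$ be a family of level $\alpha$ local intersection tests, and define the closed testing rejection set $R_\alpha(\boldsymbol\Phi)=\{i\in[m]:\boldsymbol\varphi_S=1\text{ for all }S\subseteq[m]\text{ with } i\in S\}$. If we set $\mathbf e_S=\alpha^{-1}\boldsymbol\varphi_S$ for each $S\in 2^{[m]}$, then $\mathbf E=(\mathbf e_S)_{S\in 2^{[m]}}$ is an e-collection and $R_\alpha(\boldsymbol\Phi)=R^{\mathrm{FWER}}_\alpha(\mathbf E)$. (2) Conversely, suppose $\mathbf E=(\mathbf e_S)_{S\in 2^{[m]}}$ is an e-collection for which each $\mathbf e_S$ is an e-value for the intersection hypothesis $H_S$, and let $\boldsymbol\varphi_S=\mathbf 1\{\mathbf e_S\ge\alpha^{-1}\}$. Then $\boldsymbol\Phi=(\boldsymbol\varphi_S)_{S\in 2^{[m]}}$ is a family of level $\alpha$ local intersection tests and $R_\alpha(\boldsymbol\Phi)=R^{\mathrm{FWER}}_\alpha(\mathbf E)$.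
   Context: Setting: $M$ is a set of probability measures on a measurable space; $m\ge 1$, $[m]=\{1,\dots,m\}$; hypotheses $H_1,\dots,H_m$ are subsets of $M$; for $\mathrm P\in M$, $N_{\mathrm P}=\{i\in[m]:\mathrm P\in H_i\}$; for $S\subseteq[m]$, $H_S=\bigcap_{i\in S}H_i$ (with $H_\emptyset=M$). A nonnegative random variable $\mathbf e$ is an e-value for $H\subseteq M$ if $\mathbb E_{\mathrm P}(\mathbf e)\le1$ for all $\mathrm P\in H$. An e-collection is a family $\mathbf E=(\mathbf e_S)_{S\in 2^{[m]}}$ of nonnegative random variables with $\mathbb E_{\mathrm P}(\mathbf e_{N_{\mathrm P}})\le 1$ for all $\mathrm P\in M$; by convention $\mathbf e_\emptyset=0$. A family of level $\alpha$ local intersection tests is a family $(\boldsymbol\varphi_S)_{S\in 2^{[m]}}$ of $\{0,1\}$-valued random variables with $\mathrm P(\boldsymbol\varphi_S=1)\le\alpha$ for all $\mathrm P\in H_S$ and all $S$; by convention $\boldsymbol\varphi_\emptyset=0$. For an e-collection $\mathbf E$ let $\mathcal R^{\mathrm{FWER}}_\alpha(\mathbf E)=\{R\in 2^{[m]}:\mathbf e_S\ge \mathbf 1\{|R\cap S|>0\}/\alpha\ \text{for all }S\in 2^{[m]}\}$, and let $R^{\mathrm{FWER}}_\alpha(\mathbf E)$ be the largest set in $\mathcal R^{\mathrm{FWER}}_\alpha(\mathbf E)$; it exists and equals the union of all sets in $\mathcal R^{\mathrm{FWER}}_\alpha(\mathbf E)$. *)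

theory Defs
  imports "HOL-Probability.Probability_Measure"
begin

text \<open>
  The measurable space is represented by a measure \<open>\<Omega>\<close> of which only the space and the
  sigma-algebra are used. The families indexed by subsets of \<open>{1..m}\<close> are functions on all of
  \<open>nat set\<close>, and random variables are functions on the whole sample type; values outside
  \<open>Pow {1..m}\<close> and outside \<open>space \<Omega>\<close> are irrelevant.
\<close>

definition true_indices :: "nat \<Rightarrow> (nat \<Rightarrow> 'a measure set) \<Rightarrow> 'a measure \<Rightarrow> nat set" where
  "true_indices m H P = {i \<in> {1..m}. P \<in> H i}"

text \<open>Intersecting with \<open>M\<close> only matters for \<open>S = {}\<close>, where the result is \<open>M\<close>.\<close>

definition intersection_hyp ::
    "'a measure set \<Rightarrow> (nat \<Rightarrow> 'a measure set) \<Rightarrow> nat set \<Rightarrow> 'a measure set" where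
  "intersection_hyp M H S = M \<inter> (\<Inter>i\<in>S. H i)"

text \<open>
  Nonnegative random variables take values in \<open>ennreal\<close>, with the Lebesgue integral
  \<open>nn_integral\<close> as expectation, so that non-integrability is not confused with expectation 0.
\<close>

definition e_value :: "'a measure \<Rightarrow> 'a measure set \<Rightarrow> ('a \<Rightarrow> ennreal) \<Rightarrow> bool" where
  "e_value \<Omega> H e \<longleftrightarrow> e \<in> borel_measurable \<Omega> \<and> (\<forall>P\<in>H. (\<integral>\<^sup>+\<omega>. e \<omega> \<partial>P) \<le> 1)"

definition e_collection ::
    "'a measure \<Rightarrow> 'a measure set \<Rightarrow> nat \<Rightarrow> (nat \<Rightarrow> 'a measure set)
      \<Rightarrow> (nat set \<Rightarrow> 'a \<Rightarrow> ennreal) \<Rightarrow> bool" where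
  "e_collection \<Omega> M m H e \<longleftrightarrow>
     (\<forall>S\<in>Pow {1..m}. e S \<in> borel_measurable \<Omega>) \<and>
     (\<forall>P\<in>M. (\<integral>\<^sup>+\<omega>. e (true_indices m H P) \<omega> \<partial>P) \<le> 1) \<and>
     (\<forall>\<omega>\<in>space \<Omega>. e {} \<omega> = 0)"

definition local_tests ::
    "'a measure \<Rightarrow> 'a measure set \<Rightarrow> nat \<Rightarrow> (nat \<Rightarrow> 'a measure set)
      \<Rightarrow> real \<Rightarrow> (nat set \<Rightarrow> 'a \<Rightarrow> real) \<Rightarrow> bool" where
  "local_tests \<Omega> M m H \<alpha> \<phi> \<longleftrightarrow>
     (\<forall>S\<in>Pow {1..m}. \<phi> S \<in> borel_measurable \<Omega> \<and> (\<forall>\<omega>\<in>space \<Omega>. \<phi> S \<omega> \<in> {0, 1}) \<and>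
        (\<forall>P\<in>intersection_hyp M H S. measure P {\<omega> \<in> space P. \<phi> S \<omega> = 1} \<le> \<alpha>)) \<and>
     (\<forall>\<omega>\<in>space \<Omega>. \<phi> {} \<omega> = 0)"

definition closed_testing_set :: "nat \<Rightarrow> (nat set \<Rightarrow> 'a \<Rightarrow> real) \<Rightarrow> 'a \<Rightarrow> nat set" where
  "closed_testing_set m \<phi> \<omega> = {i \<in> {1..m}. \<forall>S\<in>Pow {1..m}. i \<in> S \<longrightarrow> \<phi> S \<omega> = 1}"

definition fwer_sets ::
    "nat \<Rightarrow> real \<Rightarrow> (nat set \<Rightarrow> 'a \<Rightarrow> ennreal) \<Rightarrow> 'a \<Rightarrow> nat set set" where
  "fwer_sets m \<alpha> e \<omega> =
     {R \<in> Pow {1..m}. \<forall>S\<in>Pow {1..m}. e S \<omega> \<ge> ennreal (of_bool (card (R \<inter> S) > 0) / \<alpha>)}"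

text \<open>The largest set with respect to inclusion.\<close>

definition fwer_set :: "nat \<Rightarrow> real \<Rightarrow> (nat set \<Rightarrow> 'a \<Rightarrow> ennreal) \<Rightarrow> 'a \<Rightarrow> nat set" where
  "fwer_set m \<alpha> e \<omega> = (GREATEST R. R \<in> fwer_sets m \<alpha> e \<omega>)"

lemma Union_fwer_sets_in: "\<Union>(fwer_sets m \<alpha> e \<omega>) \<in> fwer_sets m \<alpha> e \<omega>"
proof -
  have "ennreal (of_bool (card (\<Union>(fwer_sets m \<alpha> e \<omega>) \<inter> S) > 0) / \<alpha>) \<le> e S \<omega>"
    if S: "S \<in> Pow {1..m}" for S
  proof (cases "\<Union>(fwer_sets m \<alpha> e \<omega>) \<inter> S = {}")
    case False
    then obtain R where R: "R \<in> fwer_sets m \<alpha> e \<omega>" "R \<inter> S \<noteq> {}"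
      by blast
    have "finite S"
      using S finite_subset by blast
    then have "card (R \<inter> S) > 0" "card (\<Union>(fwer_sets m \<alpha> e \<omega>) \<inter> S) > 0"
      using R(2) False by (simp_all add: card_gt_0_iff)
    moreover have "ennreal (of_bool (card (R \<inter> S) > 0) / \<alpha>) \<le> e S \<omega>"
      using R(1) S by (simp add: fwer_sets_def)
    ultimately show ?thesis
      by simp
  qed simp
  moreover have "\<Union>(fwer_sets m \<alpha> e \<omega>) \<in> Pow {1..m}"
    by (auto simp: fwer_sets_def)
  ultimately show ?thesis
    unfolding fwer_sets_def[of m \<alpha> e \<omega>] by blast
qed

lemma fwer_set_eq_Union: "fwer_set m \<alpha> e \<omega> = \<Union>(fwer_sets m \<alpha> e \<omega>)"
  unfolding fwer_set_def by (rule Greatest_equality) (auto simp: Union_fwer_sets_in)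

end

theory Submission
  imports Defs
begin

text \<open>At a fixed outcome, both constructions depend only on which local hypotheses are
  rejected. If \<open>\<phi> S\<close> equals 1 exactly when \<open>e S\<close> reaches the level
  1/\<alpha>, then \<open>R\<close> is admissible for the e-collection iff every \<open>S\<close>
  meeting \<open>R\<close> is rejected. Exchanging the quantifiers, this says that each
  \<open>i\<close> in \<open>R\<close> has all sets \<open>S\<close> containing it rejected. So the
  admissible sets are precisely the subsets of the closed testing set, which is therefore the
  largest of them (\<open>fwer_set_eq_closed_testing_set\<close>).

  The error guarantees translate by two elementary facts. A 0/1 test divided by \<alpha> has
  expectation P(test = 1)/\<alpha> (\<open>nn_integral_scaled_test_le_1\<close>); used at the index
  set of the true hypotheses of \<open>P\<close>, this gives an e-collection. Conversely, Markov's
  inequality bounds the probability that an e-value reaches 1/\<alpha>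
  (\<open>measure_e_value_threshold_le\<close>).\<close>

lemma fwer_set_eq_closed_testing_set:
  assumes "\<And>S. S \<subseteq> {1..m} \<Longrightarrow> \<phi> S \<omega> = 1 \<longleftrightarrow> ennreal (inverse \<alpha>) \<le> e S \<omega>"
  shows "closed_testing_set m \<phi> \<omega> = fwer_set m \<alpha> e \<omega>"
proof -
  have in_fwer_iff: "R \<in> fwer_sets m \<alpha> e \<omega> \<longleftrightarrow> R \<subseteq> closed_testing_set m \<phi> \<omega>" for R
  proof -
    \<comment> \<open>If \<open>R\<close> misses \<open>S\<close>, the lower bound is 0 and holds
      trivially; otherwise it is the rejection threshold. Finiteness of \<open>S\<close> makes
      positive cardinality the same as being nonempty.\<close>
    have "ennreal (of_bool (card (R \<inter> S) > 0) / \<alpha>) \<le> e S \<omega> \<longleftrightarrow> (R \<inter> S \<noteq> {} \<longrightarrow> \<phi> S \<omega> = 1)"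
      if "S \<subseteq> {1..m}" for S
      using that assms[OF that] finite_subset[OF that]
      by (cases "R \<inter> S = {}") (auto simp: card_gt_0_iff inverse_eq_divide)
    then show ?thesis
      unfolding fwer_sets_def closed_testing_set_def by blast
  qed
  show ?thesis
    unfolding fwer_set_eq_Union using in_fwer_iff by blast
qed

text \<open>This lets the level condition of the local tests be applied to \<open>P\<close> at its
  own set of true indices. If that set is empty, the intersection is \<open>M\<close>, so membership
  in \<open>M\<close> is what is used.\<close>

lemma true_indices_intersection_hyp:
  "P \<in> M \<Longrightarrow> P \<in> intersection_hyp M H (true_indices m H P)"
  by (auto simp: intersection_hyp_def true_indices_def)

lemma nn_integral_scaled_test_le_1:
  assumes "prob_space P" and "\<phi> \<in> borel_measurable P"
    and "\<And>\<omega>. \<omega> \<in> space P \<Longrightarrow> \<phi> \<omega> \<in> {0, 1 :: real}"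
    and "measure P {\<omega> \<in> space P. \<phi> \<omega> = 1} \<le> \<alpha>" and "\<alpha> > 0"
  shows "(\<integral>\<^sup>+\<omega>. ennreal (inverse \<alpha> * \<phi> \<omega>) \<partial>P) \<le> 1"
proof -
  interpret prob_space P by fact
  let ?A = "{\<omega> \<in> space P. \<phi> \<omega> = 1}"
  have A: "?A \<in> sets P"
    using assms(2) by measurable
  \<comment> \<open>A 0/1-valued function is the indicator of its rejection event.\<close>
  have "(\<integral>\<^sup>+\<omega>. ennreal (inverse \<alpha> * \<phi> \<omega>) \<partial>P)
      = (\<integral>\<^sup>+\<omega>. ennreal (inverse \<alpha>) * indicator ?A \<omega> \<partial>P)"
    using assms(3) by (intro nn_integral_cong) (force simp: indicator_def)
  also have "\<dots> = ennreal (inverse \<alpha> * prob ?A)"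
    using A \<open>\<alpha> > 0\<close> by (simp add: nn_integral_cmult_indicator emeasure_eq_measure ennreal_mult)
  also have "\<dots> \<le> 1"
    using assms(4,5) by (simp add: field_simps)
  finally show ?thesis .
qed

text \<open>Markov's inequality at the threshold 1/\<alpha>.\<close>

lemma measure_e_value_threshold_le:
  assumes "prob_space P" and [measurable]: "e \<in> borel_measurable P"
    and "(\<integral>\<^sup>+\<omega>. e \<omega> \<partial>P) \<le> 1" and "\<alpha> > 0"
  shows "measure P {\<omega> \<in> space P. ennreal (inverse \<alpha>) \<le> e \<omega>} \<le> \<alpha>"
proof -
  interpret prob_space P by fact
  \<comment> \<open>Rewrites the event into the form \<open>1 \<le> c * u x\<close> of
    \<open>nn_integral_Markov_inequality\<close>. The value infinity is a separate case: it
    satisfies both sides because \<alpha> is positive.\<close>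
  have threshold_iff: "ennreal (inverse \<alpha>) \<le> x \<longleftrightarrow> 1 \<le> ennreal \<alpha> * x" for x
    using \<open>\<alpha> > 0\<close> by (cases x) (auto simp: ennreal_mult[symmetric] ennreal_mult_top field_simps
      simp flip: ennreal_1)
  have "emeasure P {\<omega> \<in> space P. ennreal (inverse \<alpha>) \<le> e \<omega>}
      \<le> ennreal \<alpha> * (\<integral>\<^sup>+\<omega>. e \<omega> * indicator (space P) \<omega> \<partial>P)"
    using nn_integral_Markov_inequality[of e "space P" P "ennreal \<alpha>"]
    by (simp add: threshold_iff)
  also have "(\<integral>\<^sup>+\<omega>. e \<omega> * indicator (space P) \<omega> \<partial>P) = (\<integral>\<^sup>+\<omega>. e \<omega> \<partial>P)"
    by (intro nn_integral_cong) simp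
  also have "ennreal \<alpha> * \<dots> \<le> ennreal \<alpha> * 1"
    using assms(3) by (rule mult_left_mono) simp
  finally show ?thesis
    using \<open>\<alpha> > 0\<close> by (simp add: emeasure_eq_measure)
qed

theorem corollary13:
  fixes \<Omega> :: "'a measure" and M :: "'a measure set"
    and m :: nat and H :: "nat \<Rightarrow> 'a measure set" and \<alpha> :: real
  assumes "\<And>P. P \<in> M \<Longrightarrow> prob_space P \<and> sets P = sets \<Omega>"
    and "m \<ge> 1"
    and "\<And>i. i \<in> {1..m} \<Longrightarrow> H i \<subseteq> M"
    and "\<alpha> > 0"
  shows "(\<forall>\<phi>. local_tests \<Omega> M m H \<alpha> \<phi> \<longrightarrow>
            (let e = (\<lambda>S \<omega>. ennreal (inverse \<alpha> * \<phi> S \<omega>)) in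
               e_collection \<Omega> M m H e \<and>
               (\<forall>\<omega>\<in>space \<Omega>. closed_testing_set m \<phi> \<omega> = fwer_set m \<alpha> e \<omega>))) \<and>
         (\<forall>e. e_collection \<Omega> M m H e \<and>
              (\<forall>S\<in>Pow {1..m}. e_value \<Omega> (intersection_hyp M H S) (e S)) \<longrightarrow>
            (let \<phi> = (\<lambda>S \<omega>. of_bool (e S \<omega> \<ge> ennreal (inverse \<alpha>))) in
               local_tests \<Omega> M m H \<alpha> \<phi> \<and>
               (\<forall>\<omega>\<in>space \<Omega>. closed_testing_set m \<phi> \<omega> = fwer_set m \<alpha> e \<omega>)))"
proof -
  have probM: "prob_space P" and setsM: "sets P = sets \<Omega>" and spaceM: "space P = space \<Omega>"
    if "P \<in> M" for P
    using assms(1)[OF that] sets_eq_imp_space_eq by auto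
  have hyp_sub: "P \<in> M" if "P \<in> intersection_hyp M H S" for P S
    using that by (simp add: intersection_hyp_def)
  show ?thesis
    unfolding Let_def
  proof (intro conjI allI impI ballI)
    fix \<phi> assume \<phi>: "local_tests \<Omega> M m H \<alpha> \<phi>"
    let ?e = "\<lambda>S \<omega>. ennreal (inverse \<alpha> * \<phi> S \<omega>)"
    have \<phi>_meas: "\<phi> S \<in> borel_measurable \<Omega>" if "S \<subseteq> {1..m}" for S
      using \<phi> that by (auto simp: local_tests_def)
    have \<phi>_01: "\<phi> S \<omega> \<in> {0, 1}" if "S \<subseteq> {1..m}" "\<omega> \<in> space \<Omega>" for S \<omega>
      using \<phi> that unfolding local_tests_def by blast
    have "(\<integral>\<^sup>+\<omega>. ?e (true_indices m H P) \<omega> \<partial>P) \<le> 1" if P: "P \<in> M" for P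
    proof (rule nn_integral_scaled_test_le_1[OF probM[OF P] _ _ _ \<open>\<alpha> > 0\<close>])
      have N: "true_indices m H P \<subseteq> {1..m}"
        by (auto simp: true_indices_def)
      show "\<phi> (true_indices m H P) \<in> borel_measurable P"
        using \<phi>_meas[OF N] measurable_cong_sets[OF setsM[OF P] refl] by blast
      show "\<phi> (true_indices m H P) \<omega> \<in> {0, 1}" if "\<omega> \<in> space P" for \<omega>
        using \<phi>_01[OF N] that spaceM[OF P] by simp
      show "measure P {\<omega> \<in> space P. \<phi> (true_indices m H P) \<omega> = 1} \<le> \<alpha>"
        using \<phi> N true_indices_intersection_hyp[OF P] unfolding local_tests_def by blast
    qed
    moreover have "?e {} \<omega> = 0" if "\<omega> \<in> space \<Omega>" for \<omega>
      using \<phi> that by (simp add: local_tests_def)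
    ultimately show "e_collection \<Omega> M m H ?e"
      using \<phi>_meas unfolding e_collection_def by (auto intro!: measurable_compose[OF _ measurable_ennreal])
    show "closed_testing_set m \<phi> \<omega> = fwer_set m \<alpha> ?e \<omega>" if "\<omega> \<in> space \<Omega>" for \<omega>
    proof (rule fwer_set_eq_closed_testing_set)
      \<comment> \<open>The scaled test takes only the values 0 and 1/\<alpha>, and 0 lies strictly
        below the threshold.\<close>
      show "\<phi> S \<omega> = 1 \<longleftrightarrow> ennreal (inverse \<alpha>) \<le> ?e S \<omega>" if "S \<subseteq> {1..m}" for S
        using \<phi>_01[OF that \<open>\<omega> \<in> space \<Omega>\<close>] \<open>\<alpha> > 0\<close> by auto
    qed
  next
    fix e
    assume e: "e_collection \<Omega> M m H e \<and>
      (\<forall>S\<in>Pow {1..m}. e_value \<Omega> (intersection_hyp M H S) (e S))"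
    let ?\<phi> = "\<lambda>S \<omega>. of_bool (ennreal (inverse \<alpha>) \<le> e S \<omega>) :: real"
    have e_meas: "e S \<in> borel_measurable \<Omega>" if "S \<subseteq> {1..m}" for S
      using e that by (auto simp: e_collection_def)
    have "measure P {\<omega> \<in> space P. ?\<phi> S \<omega> = 1} \<le> \<alpha>"
      if S: "S \<subseteq> {1..m}" and P: "P \<in> intersection_hyp M H S" for S P
    proof -
      have "e S \<in> borel_measurable P"
        using e_meas[OF S] measurable_cong_sets[OF setsM[OF hyp_sub[OF P]] refl] by blast
      moreover have "(\<integral>\<^sup>+\<omega>. e S \<omega> \<partial>P) \<le> 1"
        using e S P by (auto simp: e_value_def)
      ultimately show ?thesis
        using measure_e_value_threshold_le[OF probM[OF hyp_sub[OF P]]] \<open>\<alpha> > 0\<close> by simp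
    qed
    moreover have "?\<phi> S \<in> borel_measurable \<Omega>" if "S \<subseteq> {1..m}" for S
      using e_meas[OF that] by measurable
    \<comment> \<open>The convention \<open>e {} = 0\<close> carries over because the threshold
      1/\<alpha> is positive.\<close>
    moreover have "?\<phi> {} \<omega> = 0" if "\<omega> \<in> space \<Omega>" for \<omega>
      using e that \<open>\<alpha> > 0\<close> by (simp add: e_collection_def)
    ultimately show "local_tests \<Omega> M m H \<alpha> ?\<phi>"
      by (auto simp: local_tests_def)
    show "closed_testing_set m ?\<phi> \<omega> = fwer_set m \<alpha> e \<omega>" for \<omega>
      by (intro fwer_set_eq_closed_testing_set) simp
  qed
qed

end
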